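(* Let $I\subset\mathbb{R}$ be an open interval, let $A$ be an asymmetric fuzzy number with $a_m=0.5(\underline{a}_1+\overline{a}_1)$, where $[A]_1=[\underline a_1,\overline a_1]$, and let $f:I\to\mathbb{R}_{\mathcal{F}(A)}$ be three times continuously differentiable in $I$ with $f(t)=r(t)+q(t)A$ for all $t\in I$, where $r,q:I\to\mathbb{R}$. Let $t^*\in I$. (a) If $r'(t^* )+q'(t^* )a_m=0$ and $r''(t^* )+q''(t^* )a_m>0$, then $f(t^* )$ is a local minimum of $f$. (b) If $r'(t^* )+q'(t^* )a_m=0$ and $r''(t^* )+q''(t^* )a_m<0$, then $f(t^* )$ is a local maximum of $f$.
   Context: A fuzzy subset of $\mathbb{R}$ is a function $A:\mathbb{R}\to[0,1]$; its $\alpha$-levels are $[A]_\alpha=\{x: A(x)\geq\alpha\}$ for $0<\alpha\leq1$ and $[A]_0=\overline{\{x:A(x)>0\}}$. $A$ is a fuzzy number if all its $\alpha$-levels are nonempty closed intervals $[\underline a_\alpha,\overline a_\alpha]$ and $\{x:A(x)>0\}$ is bounded. For $r,q\in\mathbb{R}$, $r+qA$ is the fuzzy number with $[r+qA]_\alpha=\{r+qx: x\in[A]_\alpha\}$ for every $\alpha\in[0,1]$. $A$ is asymmetric if for every $x\in\mathbb{R}$ there exists $y\in\mathbb{R}$ with $A(x-y)\neq A(x+y)$. Put $\mathbb{R}_{\mathcal{F}(A)}=\{r+qA: r,q\in\mathbb{R}\}$. When $A$ is asymmetric, $(r,q)\mapsto r+qA$ is a bijection from $\mathbb{R}^2$ onto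 $\mathbb{R}_{\mathcal{F}(A)}$, and $\mathbb{R}_{\mathcal{F}(A)}$ is a 2-dimensional real vector space with $(r_B+q_BA)\oplus(r_C+q_CA)=(r_B+r_C)+(q_B+q_C)A$, $\lambda(r+qA)=\lambda r+(\lambda q)A$ and $B\ominus C=B\oplus(-1)C$, normed by $\|r+qA\|=|q|+|r+qa_m|$. Order: for $B=r_B+q_BA$, $C=r_C+q_CA$, $B\leq C$ if and only if (I) $r_B+q_Ba_m<r_C+q_Ca_m$; or (II) $r_B+q_Ba_m=r_C+q_Ca_m$ and $|q_B|<|q_C|$; or (III) $r_B+q_Ba_m=r_C+q_Ca_m$, $|q_B|=|q_C|$ and $q_B\leq q_C$. $f$ is differentiable at $t$ if $f'(t)=\lim_{h\to0}\frac{f(t+h)\ominus f(t)}{h}$ exists in $\mathbb{R}_{\mathcal{F}(A)}$; equivalently, $r$ and $q$ are differentiable at $t$, and then $f'(t)=r'(t)+q'(t)A$; higher derivatives are defined iteratively. $f(t^* )$ is a local minimum (maximum) of $f$ if $f(t^* )\leq f(z)$ ($f(z)\leq f(t^* )$) for all $z$ in a neighborhood of $t^*$ in $I$. *)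

theory Defs
  imports "HOL-Analysis.Analysis"
begin

definition level :: "(real \<Rightarrow> real) \<Rightarrow> real \<Rightarrow> real set" where
  "level A \<alpha> = (if \<alpha> = 0 then closure {x. A x > 0} else {x. A x \<ge> \<alpha>})"

definition fuzzy_number :: "(real \<Rightarrow> real) \<Rightarrow> bool" where
  "fuzzy_number A \<longleftrightarrow>
     (\<forall>x. A x \<in> {0..1}) \<and>
     (\<forall>\<alpha>\<in>{0..1}. \<exists>a b. a \<le> b \<and> level A \<alpha> = {a..b}) \<and>
     bounded {x. A x > 0}"

definition asymmetric :: "(real \<Rightarrow> real) \<Rightarrow> bool" where
  "asymmetric A \<longleftrightarrow> (\<forall>x. \<exists>y. A (x - y) \<noteq> A (x + y))"

text \<open>The midpoint \<open>a\<^sub>m\<close> of the 1-level.\<close>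

definition core_mid :: "(real \<Rightarrow> real) \<Rightarrow> real" where
  "core_mid A = (Inf (level A 1) + Sup (level A 1)) / 2"

text \<open>The fuzzy number \<open>r + q A\<close>, determined by its levels; \<open>fz_affine_eq\<close> below shows
  that the description is proper.\<close>

definition fz_affine :: "real \<Rightarrow> real \<Rightarrow> (real \<Rightarrow> real) \<Rightarrow> real \<Rightarrow> real" where
  "fz_affine r q A =
     (THE B. fuzzy_number B \<and> (\<forall>\<alpha>\<in>{0..1}. level B \<alpha> = (\<lambda>x. r + q * x) ` level A \<alpha>))"

definition fz_space :: "(real \<Rightarrow> real) \<Rightarrow> (real \<Rightarrow> real) set" where
  "fz_space A = {fz_affine r q A | r q. True}"

text \<open>The coordinates \<open>(r, q)\<close> of \<open>r + q A\<close>. They are meaningful only for asymmetric \<open>A\<close>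
  and elements of \<open>fz_space A\<close>; see \<open>fz_coords_affine\<close> below.\<close>

definition fz_coords :: "(real \<Rightarrow> real) \<Rightarrow> (real \<Rightarrow> real) \<Rightarrow> real \<times> real" where
  "fz_coords A = inv (\<lambda>(r, q). fz_affine r q A)"

definition fz_add :: "(real \<Rightarrow> real) \<Rightarrow> (real \<Rightarrow> real) \<Rightarrow> (real \<Rightarrow> real) \<Rightarrow> (real \<Rightarrow> real)" where
  "fz_add A B C =
     (case (fz_coords A B, fz_coords A C) of ((rB, qB), (rC, qC)) \<Rightarrow> fz_affine (rB + rC) (qB + qC) A)"

definition fz_scale :: "(real \<Rightarrow> real) \<Rightarrow> real \<Rightarrow> (real \<Rightarrow> real) \<Rightarrow> (real \<Rightarrow> real)" where
  "fz_scale A c B = (case fz_coords A B of (r, q) \<Rightarrow> fz_affine (c * r) (c * q) A)"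

definition fz_diff :: "(real \<Rightarrow> real) \<Rightarrow> (real \<Rightarrow> real) \<Rightarrow> (real \<Rightarrow> real) \<Rightarrow> (real \<Rightarrow> real)" where
  "fz_diff A B C = fz_add A B (fz_scale A (-1) C)"

definition fz_norm :: "(real \<Rightarrow> real) \<Rightarrow> (real \<Rightarrow> real) \<Rightarrow> real" where
  "fz_norm A B = (case fz_coords A B of (r, q) \<Rightarrow> \<bar>q\<bar> + \<bar>r + q * core_mid A\<bar>)"

definition fz_le :: "(real \<Rightarrow> real) \<Rightarrow> (real \<Rightarrow> real) \<Rightarrow> (real \<Rightarrow> real) \<Rightarrow> bool" where
  "fz_le A B C \<longleftrightarrow>
     (case (fz_coords A B, fz_coords A C) of ((rB, qB), (rC, qC)) \<Rightarrow>
        let mB = rB + qB * core_mid A; mC = rC + qC * core_mid A in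
          mB < mC \<or>
          mB = mC \<and> \<bar>qB\<bar> < \<bar>qC\<bar> \<or>
          mB = mC \<and> \<bar>qB\<bar> = \<bar>qC\<bar> \<and> qB \<le> qC)"

definition has_fz_deriv ::
    "(real \<Rightarrow> real) \<Rightarrow> (real \<Rightarrow> real \<Rightarrow> real) \<Rightarrow> (real \<Rightarrow> real) \<Rightarrow> real \<Rightarrow> bool" where
  "has_fz_deriv A f D t \<longleftrightarrow>
     D \<in> fz_space A \<and>
     ((\<lambda>h. fz_norm A (fz_diff A (fz_scale A (1 / h) (fz_diff A (f (t + h)) (f t))) D)) \<longlongrightarrow> 0) (at 0)"

definition fz_continuous_on ::
    "(real \<Rightarrow> real) \<Rightarrow> real set \<Rightarrow> (real \<Rightarrow> real \<Rightarrow> real) \<Rightarrow> bool" where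
  "fz_continuous_on A I f \<longleftrightarrow>
     (\<forall>t\<in>I. ((\<lambda>s. fz_norm A (fz_diff A (f s) (f t))) \<longlongrightarrow> 0) (at t within I))"

text \<open>\<open>n\<close> times continuously differentiable, for open \<open>I\<close> and \<open>f\<close> mapping \<open>I\<close> into
  \<open>fz_space A\<close>.\<close>

primrec fz_C_on ::
    "nat \<Rightarrow> (real \<Rightarrow> real) \<Rightarrow> real set \<Rightarrow> (real \<Rightarrow> real \<Rightarrow> real) \<Rightarrow> bool" where
  "fz_C_on 0 A I f \<longleftrightarrow> fz_continuous_on A I f"
| "fz_C_on (Suc n) A I f \<longleftrightarrow> (\<exists>g. (\<forall>t\<in>I. has_fz_deriv A f (g t) t) \<and> fz_C_on n A I g)"

definition fz_local_min ::
    "(real \<Rightarrow> real) \<Rightarrow> real set \<Rightarrow> (real \<Rightarrow> real \<Rightarrow> real) \<Rightarrow> real \<Rightarrow> bool" where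
  "fz_local_min A I f t \<longleftrightarrow> (\<exists>U. open U \<and> t \<in> U \<and> (\<forall>z\<in>U \<inter> I. fz_le A (f t) (f z)))"

definition fz_local_max ::
    "(real \<Rightarrow> real) \<Rightarrow> real set \<Rightarrow> (real \<Rightarrow> real \<Rightarrow> real) \<Rightarrow> real \<Rightarrow> bool" where
  "fz_local_max A I f t \<longleftrightarrow> (\<exists>U. open U \<and> t \<in> U \<and> (\<forall>z\<in>U \<inter> I. fz_le A (f z) (f t)))"


lemma fuzzy_number_eqI:
  assumes "fuzzy_number B" "fuzzy_number C" "\<And>\<alpha>. \<alpha> \<in> {0..1} \<Longrightarrow> level B \<alpha> = level C \<alpha>"
  shows "B = C"
proof
  fix x
  have b: "0 \<le> B x" "B x \<le> 1" "0 \<le> C x" "C x \<le> 1"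
    using assms(1,2) by (auto simp: fuzzy_number_def)
  have *: "\<alpha> \<le> B x \<longleftrightarrow> \<alpha> \<le> C x" if "0 < \<alpha>" "\<alpha> \<le> 1" for \<alpha>
    using assms(3)[of \<alpha>] that by (auto simp: level_def)
  show "B x = C x"
    using *[of "B x"] *[of "C x"] b by linarith
qed

lemma fz_affine_props:
  fixes r q :: real
  assumes A: "fuzzy_number A"
  defines "B \<equiv> (\<lambda>x. if q = 0 then if x = r then 1 else 0 else A ((x - r) / q))"
  shows "\<And>\<alpha>. \<alpha> \<in> {0..1} \<Longrightarrow> level B \<alpha> = (\<lambda>x. r + q * x) ` level A \<alpha>" "fuzzy_number B"
proof -
  have ne: "level A \<alpha> \<noteq> {}" if "\<alpha> \<in> {0..1}" for \<alpha>
    using A that by (fastforce simp: fuzzy_number_def)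
  show lev: "level B \<alpha> = (\<lambda>x. r + q * x) ` level A \<alpha>" if \<alpha>: "\<alpha> \<in> {0..1}" for \<alpha>
  proof (cases "q = 0")
    case True
    have "(\<lambda>x. r + q * x) ` level A \<alpha> = {r}"
      using ne[OF \<alpha>] True by auto
    moreover have "{x. B x > 0} = {r}" "\<alpha> \<noteq> 0 \<Longrightarrow> {x. B x \<ge> \<alpha>} = {r}"
      using True \<alpha> by (auto simp: B_def split: if_splits)
    ultimately show ?thesis by (simp add: level_def)
  next
    case False
    have im: "{x. P (A ((x - r) / q))} = (\<lambda>x. r + q * x) ` {x. P (A x)}" for P
    proof (intro set_eqI iffI)
      fix x assume "x \<in> {x. P (A ((x - r) / q))}"
      then show "x \<in> (\<lambda>x. r + q * x) ` {x. P (A x)}"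
        using False by (intro image_eqI[of _ _ "(x - r) / q"]) simp_all
    next
      fix x assume "x \<in> (\<lambda>x. r + q * x) ` {x. P (A x)}"
      then obtain y where "x = r + q * y" "P (A y)" by blast
      then show "x \<in> {x. P (A ((x - r) / q))}" using False by simp
    qed
    have cl: "closure ((\<lambda>x. r + q * x) ` S) = (\<lambda>x. r + q * x) ` closure S" for S :: "real set"
      using closure_translation[of r "(*) q ` S"] closure_scaleR[of q S, symmetric]
      by (simp add: image_image)
    show ?thesis
      using False im[of "\<lambda>y. 0 < y"] im[of "\<lambda>y. \<alpha> \<le> y"] by (simp add: level_def B_def cl)
  qed
  have int: "\<exists>a b. a \<le> b \<and> level B \<alpha> = {a..b}" if \<alpha>: "\<alpha> \<in> {0..1}" for \<alpha>
  proof -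
    obtain a b where ab: "a \<le> b" "level A \<alpha> = {a..b}"
      using A \<alpha> unfolding fuzzy_number_def by blast
    have "(\<lambda>x. r + q * x) ` {a..b} =
        (if 0 \<le> q then {r + q * a..r + q * b} else {r + q * b..r + q * a})"
      using ab(1) image_affinity_atLeastAtMost[of q r a b] by (simp add: add.commute)
    moreover have "r + q * a \<le> r + q * b" if "0 \<le> q"
      using ab(1) that by (simp add: mult_left_mono)
    moreover have "r + q * b \<le> r + q * a" if "\<not> 0 \<le> q"
      using ab(1) that by (simp add: mult_left_mono_neg)
    ultimately show ?thesis
      unfolding lev[OF \<alpha>] ab(2) by metis
  qed
  obtain a b where "level B 0 = {a..b}"
    using int[of 0] by auto
  then have "{x. B x > 0} \<subseteq> {a..b}"
    using closure_subset[of "{x. B x > 0}"] by (simp add: level_def)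
  then have "bounded {x. B x > 0}"
    using bounded_closed_interval bounded_subset by blast
  moreover have "\<forall>x. B x \<in> {0..1}"
    using A by (auto simp: fuzzy_number_def B_def)
  ultimately show "fuzzy_number B"
    using int by (auto simp: fuzzy_number_def)
qed

lemma fz_affine_eq:
  assumes "fuzzy_number A"
  shows "fz_affine r q A = (\<lambda>x. if q = 0 then if x = r then 1 else 0 else A ((x - r) / q))"
  unfolding fz_affine_def
  using fz_affine_props[OF assms, where q = q and r = r]
  by (intro the_equality conjI ballI) (auto intro!: fuzzy_number_eqI)

lemma level_fz_affine:
  assumes "fuzzy_number A" "\<alpha> \<in> {0..1}"
  shows "level (fz_affine r q A) \<alpha> = (\<lambda>x. r + q * x) ` level A \<alpha>"
  using fz_affine_props(1)[OF assms] by (simp add: fz_affine_eq[OF assms(1)])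

lemma inj_fz_affine:
  assumes A: "fuzzy_number A" and asym: "asymmetric A"
  shows "inj (\<lambda>(r, q). fz_affine r q A)"
proof -
  have "(0::real) \<in> {0..1}" by simp
  then obtain a b where ab: "a \<le> b" and l0: "level A 0 = {a..b}"
    using A unfolding fuzzy_number_def by blast
  have out: "A x = 0" if "x \<notin> {a..b}" for x
  proof -
    have "{x. A x > 0} \<subseteq> {a..b}"
      using l0 closure_subset[of "{x. A x > 0}"] by (simp add: level_def)
    then have "\<not> A x > 0" using that by blast
    moreover have "A x \<ge> 0" using A by (auto simp: fuzzy_number_def)
    ultimately show ?thesis by simp
  qed
  have "a \<noteq> b"
  proof
    assume "a = b"
    then have "A (a - y) = A (a + y)" for y
      using out[of "a - y"] out[of "a + y"] by (cases "y = 0") auto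
    then show False using asym by (auto simp: asymmetric_def)
  qed
  with ab have lt: "a < b" by simp
  have "r = r' \<and> q = q'" if eq: "fz_affine r q A = fz_affine r' q' A" for r q r' q'
  proof -
    have img: "(\<lambda>x. r + q * x) ` {a..b} = (\<lambda>x. r' + q' * x) ` {a..b}"
      using level_fz_affine[OF A, of 0 r q] level_fz_affine[OF A, of 0 r' q'] eq l0 by simp
    have S: "(\<lambda>x. s + p * x) ` {a..b} =
        {min (s + p * a) (s + p * b)..max (s + p * a) (s + p * b)}" for s p
    proof -
      have "(\<lambda>x. s + p * x) ` {a..b} =
          (if 0 \<le> p then {s + p * a..s + p * b} else {s + p * b..s + p * a})"
        using lt image_affinity_atLeastAtMost[of p s a b] by (simp add: add.commute)
      moreover have "s + p * a \<le> s + p * b" if "0 \<le> p"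
        using lt that by (simp add: mult_left_mono)
      moreover have "s + p * b \<le> s + p * a" if "\<not> 0 \<le> p"
        using lt that by (simp add: mult_left_mono_neg)
      ultimately show ?thesis by (metis min.absorb1 min.absorb2 max.absorb1 max.absorb2)
    qed
    have ends: "min (r + q * a) (r + q * b) = min (r' + q' * a) (r' + q' * b)"
      "max (r + q * a) (r + q * b) = max (r' + q' * a) (r' + q' * b)"
      using img unfolding S by (auto simp: Icc_eq_Icc)
    consider "r + q * a = r' + q' * a" "r + q * b = r' + q' * b"
      | "r + q * a = r' + q' * b" "r + q * b = r' + q' * a"
      using ends by (auto simp: min_def max_def split: if_splits)
    then show ?thesis
    proof cases
      case 1
      then have "(q - q') * (b - a) = 0" by (simp add: algebra_simps)
      then show ?thesis using 1 lt by auto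
    next
      case 2
      then have "(q + q') * (b - a) = 0" by (simp add: algebra_simps)
      then have q': "q' = - q" using lt by auto
      show ?thesis
      proof (cases "q = 0")
        case True
        then show ?thesis using 2 q' by simp
      next
        case False
        define c where "c = (r' - r) / q / 2"
        have "A (c - y) = A (c + y)" for y
        proof -
          have "A ((r + q * (c + y) - r) / q) = A ((r + q * (c + y) - r') / q')"
            using fun_cong[OF eq, of "r + q * (c + y)"] False q' by (simp add: fz_affine_eq[OF A])
          moreover have "(r + q * (c + y) - r') / q' = c - y"
            using False unfolding c_def q' by (simp add: field_simps)
          ultimately show ?thesis using False by simp
        qed
        then show ?thesis using asym by (auto simp: asymmetric_def)
      qed
    qed
  qed
  then show ?thesis by (auto simp: inj_def)
qed

lemma fz_coords_affine [simp]:
  assumes "fuzzy_number A" "asymmetric A"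
  shows "fz_coords A (fz_affine r q A) = (r, q)"
  using inv_f_f[OF inj_fz_affine[OF assms], of "(r, q)"] by (simp add: fz_coords_def)

end

theory Submission
  imports Defs
begin

text \<open>
  The order compares the real numbers \<open>m\<^sub>B = r\<^sub>B + q\<^sub>B a\<^sub>m\<close> first, so it suffices that
  \<open>m s = r s + q s a\<^sub>m\<close> has a \<^emph>\<open>strict\<close> local extremum at \<open>t\<close>: a strict inequality between the
  values of \<open>m\<close> decides the order by clause (I), and the tie-breaking clauses are met only at
  \<open>t\<close> itself, where reflexivity settles them.

  Strictness comes from the second derivative test (\<open>second_deriv_test_strict_min\<close>), applied
  to \<open>m\<close> for a minimum and to \<open>- m\<close> for a maximum. Its hypotheses are about derivatives of
  real functions, and they are supplied by \<open>has_fz_deriv_coords\<close>: the norm of \<open>r + q A\<close> is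
  the \<open>\<ell>\<^sup>1\<close> norm of \<open>(q, r + q a\<^sub>m)\<close>, which is an invertible linear image of \<open>(r, q)\<close>, so that
  differentiability in the fuzzy space is differentiability of both coordinates.
  Using it for \<open>f\<close> on all of \<open>I\<close> and then for the derivative of \<open>f\<close> at \<open>t\<close> identifies
  \<open>r'\<close>, \<open>q'\<close>, \<open>r''\<close> and \<open>q''\<close> (\<open>fz_C2_coords\<close>).
\<close>

lemma fz_norm_diff_quotient:
  assumes "fuzzy_number A" "asymmetric A"
  shows "fz_norm A (fz_diff A
           (fz_scale A c (fz_diff A (fz_affine r1 q1 A) (fz_affine r0 q0 A))) (fz_affine r' q' A)) =
         \<bar>c * (q1 - q0) - q'\<bar> + \<bar>(c * (r1 - r0) - r') + (c * (q1 - q0) - q') * core_mid A\<bar>"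
  using assms by (simp add: fz_norm_def fz_diff_def fz_add_def fz_scale_def)

text \<open>The norm dominates \<open>\<bar>q\<bar>\<close> and \<open>\<bar>r + q a\<^sub>m\<bar>\<close>. A norm limit therefore gives the limits of \<open>q\<close>
  and of \<open>r + q a\<^sub>m\<close>, and the limit of \<open>r\<close> is recovered from these two.\<close>

lemma has_fz_deriv_coords:
  fixes f :: "real \<Rightarrow> real \<Rightarrow> real"
  assumes A: "fuzzy_number A" "asymmetric A"
    and I: "open I" "t \<in> I"
    and f: "\<forall>s\<in>I. f s = fz_affine (r s) (q s) A"
    and D: "has_fz_deriv A f (fz_affine r' q' A) t"
  shows "(r has_real_derivative r') (at t)" "(q has_real_derivative q') (at t)"
proof -
  define R where "R h = (r (t + h) - r t) / h - r'" for h
  define Q where "Q h = (q (t + h) - q t) / h - q'" for h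
  define N where "N h = fz_norm A (fz_diff A
    (fz_scale A (1 / h) (fz_diff A (f (t + h)) (f t))) (fz_affine r' q' A))" for h
  have N: "(N \<longlongrightarrow> 0) (at 0)"
    using D unfolding has_fz_deriv_def N_def by blast
  have "((\<lambda>h. t + h) \<longlongrightarrow> t) (at 0)"
    by (auto intro!: tendsto_eq_intros)
  then have "\<forall>\<^sub>F h in at 0. t + h \<in> I"
    using I by (rule topological_tendstoD)
  then have eq: "\<forall>\<^sub>F h in at 0. N h = \<bar>Q h\<bar> + \<bar>R h + Q h * core_mid A\<bar>"
  proof eventually_elim
    case (elim h)
    then show ?case
      by (simp add: N_def f I fz_norm_diff_quotient[OF A] R_def Q_def)
  qed
  have Q: "(Q \<longlongrightarrow> 0) (at 0)"
    by (rule Lim_null_comparison[OF _ N]) (use eq in eventually_elim, auto)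
  have M: "((\<lambda>h. R h + Q h * core_mid A) \<longlongrightarrow> 0) (at 0)"
    by (rule Lim_null_comparison[OF _ N]) (use eq in eventually_elim, auto)
  have R: "(R \<longlongrightarrow> 0) (at 0)"
    using tendsto_diff[OF M tendsto_mult_right[OF Q, of "core_mid A"]] by simp
  show "(r has_real_derivative r') (at t)"
    using R unfolding DERIV_def R_def by (rule LIM_zero_cancel)
  show "(q has_real_derivative q') (at t)"
    using Q unfolding DERIV_def Q_def by (rule LIM_zero_cancel)
qed

text \<open>The derivative of \<open>f\<close> has coordinates \<open>(r', q')\<close> at every point of the open set \<open>I\<close>, not
  only at \<open>t\<close>; this is what allows the previous lemma to be applied to it in turn.\<close>

lemma fz_C2_coords:
  fixes f :: "real \<Rightarrow> real \<Rightarrow> real"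
  assumes A: "fuzzy_number A" "asymmetric A"
    and I: "open I" "t \<in> I"
    and f: "\<forall>s\<in>I. f s = fz_affine (r s) (q s) A"
    and C2: "fz_C_on (Suc (Suc n)) A I f"
  shows "\<And>s. s \<in> I \<Longrightarrow> (r has_real_derivative deriv r s) (at s)"
    and "\<And>s. s \<in> I \<Longrightarrow> (q has_real_derivative deriv q s) (at s)"
    and "(deriv r has_real_derivative deriv (deriv r) t) (at t)"
    and "(deriv q has_real_derivative deriv (deriv q) t) (at t)"
proof -
  obtain g k where g: "\<And>s. s \<in> I \<Longrightarrow> has_fz_deriv A f (g s) s"
    and k: "\<And>s. s \<in> I \<Longrightarrow> has_fz_deriv A g (k s) s"
    using C2 by auto
  have *: "(r has_real_derivative deriv r s) (at s) \<and> (q has_real_derivative deriv q s) (at s) \<and>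
      g s = fz_affine (deriv r s) (deriv q s) A" if s: "s \<in> I" for s
  proof -
    obtain r' q' where g': "g s = fz_affine r' q' A"
      using g[OF s] by (auto simp: has_fz_deriv_def fz_space_def)
    have "(r has_real_derivative r') (at s)" "(q has_real_derivative q') (at s)"
      using has_fz_deriv_coords[OF A I(1) s f] g[OF s] g' by auto
    then show ?thesis using g' DERIV_imp_deriv by metis
  qed
  then show "\<And>s. s \<in> I \<Longrightarrow> (r has_real_derivative deriv r s) (at s)"
    "\<And>s. s \<in> I \<Longrightarrow> (q has_real_derivative deriv q s) (at s)"
    by auto
  obtain r'' q'' where "k t = fz_affine r'' q'' A"
    using k[OF I(2)] by (auto simp: has_fz_deriv_def fz_space_def)
  then have "(deriv r has_real_derivative r'') (at t)" "(deriv q has_real_derivative q'') (at t)"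
    using has_fz_deriv_coords[OF A I, of g "deriv r" "deriv q"] * k[OF I(2)] by auto
  then show "(deriv r has_real_derivative deriv (deriv r) t) (at t)"
    "(deriv q has_real_derivative deriv (deriv q) t) (at t)"
    using DERIV_imp_deriv by metis+
qed

text \<open>Since \<open>m'\<close> vanishes at \<open>t\<close> with positive slope, it is negative just left of \<open>t\<close> and
  positive just right of it, so \<open>m\<close> strictly decreases up to \<open>t\<close> and strictly increases after.\<close>

lemma second_deriv_test_strict_min:
  fixes m m' :: "real \<Rightarrow> real"
  assumes I: "open I" "t \<in> I"
    and m: "\<And>s. s \<in> I \<Longrightarrow> (m has_real_derivative m' s) (at s)"
    and m'': "(m' has_real_derivative c) (at t)"
    and crit: "m' t = 0" and c: "c > 0"
  shows "\<exists>U. open U \<and> t \<in> U \<and> (\<forall>z\<in>U \<inter> I - {t}. m t < m z)"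
proof -
  obtain e where e: "e > 0" "\<And>z. dist z t < e \<Longrightarrow> z \<in> I"
    using I by (auto simp: open_dist)
  obtain dr where dr: "dr > 0" "\<And>h. 0 < h \<Longrightarrow> h < dr \<Longrightarrow> 0 < m' (t + h)"
    using DERIV_pos_inc_right[OF m'' c] crit by auto
  obtain dl where dl: "dl > 0" "\<And>h. 0 < h \<Longrightarrow> h < dl \<Longrightarrow> m' (t - h) < 0"
    using DERIV_pos_inc_left[OF m'' c] crit by auto
  define d where "d = Min {e, dr, dl}"
  have d: "d > 0" "d \<le> e" "d \<le> dr" "d \<le> dl"
    using e(1) dr(1) dl(1) by (auto simp: d_def)
  have deriv: "(m has_real_derivative m' x) (at x)" if "\<bar>x - t\<bar> < d" for x
    using that d e(2) m by (auto simp: dist_real_def)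
  then have cont: "continuous_on S m" if "\<And>x. x \<in> S \<Longrightarrow> \<bar>x - t\<bar> < d" for S
    using that by (meson DERIV_isCont continuous_at_imp_continuous_on)
  have "m t < m z" if z: "z \<in> ball t d" "z \<noteq> t" for z
  proof (cases "t < z")
    case True
    have "\<exists>y. (m has_real_derivative y) (at x) \<and> 0 < y" if "t < x" "x < z" for x
      using deriv[of x] dr(2)[of "x - t"] that z d by (auto simp: dist_real_def)
    then show ?thesis
      using True z by (intro DERIV_pos_imp_increasing_open[of t z m] cont) (auto simp: dist_real_def)
  next
    case False
    have "\<exists>y. (m has_real_derivative y) (at x) \<and> y < 0" if "z < x" "x < t" for x
      using deriv[of x] dl(2)[of "t - x"] that z d by (auto simp: dist_real_def)
    then show ?thesis
      using False z by (intro DERIV_neg_imp_decreasing_open[of z t m] cont) (auto simp: dist_real_def)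
  qed
  then show ?thesis using d(1) by (intro exI[of _ "ball t d"]) auto
qed

lemma fz_le_affineI:
  assumes "fuzzy_number A" "asymmetric A"
    and "rB + qB * core_mid A < rC + qC * core_mid A \<or> rB = rC \<and> qB = qC"
  shows "fz_le A (fz_affine rB qB A) (fz_affine rC qC A)"
  using assms by (auto simp: fz_le_def)

theorem lemma3:
  fixes I :: "real set" and A :: "real \<Rightarrow> real" and f :: "real \<Rightarrow> real \<Rightarrow> real"
    and r q :: "real \<Rightarrow> real" and t :: real
  assumes "open I" and "is_interval I"
    and "fuzzy_number A" and "asymmetric A"
    and "f ` I \<subseteq> fz_space A"
    and "fz_C_on 3 A I f"
    and "\<forall>s\<in>I. f s = fz_affine (r s) (q s) A"
    and "t \<in> I"
  shows "(deriv r t + deriv q t * core_mid A = 0 \<and>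
          deriv (deriv r) t + deriv (deriv q) t * core_mid A > 0 \<longrightarrow> fz_local_min A I f t) \<and>
         (deriv r t + deriv q t * core_mid A = 0 \<and>
          deriv (deriv r) t + deriv (deriv q) t * core_mid A < 0 \<longrightarrow> fz_local_max A I f t)"
proof -
  define a where "a = core_mid A"
  define m where "m s = r s + q s * a" for s
  define m' where "m' s = deriv r s + deriv q s * a" for s
  define c where "c = deriv (deriv r) t + deriv (deriv q) t * a"
  note A = assms(3,4) and I = assms(1,8) and f = assms(7)
  have "fz_C_on (Suc (Suc 1)) A I f"
    using assms(6) by (simp add: numeral_3_eq_3)
  note coords = fz_C2_coords[OF A I f this]
  have m: "(m has_real_derivative m' s) (at s)" if "s \<in> I" for s
    unfolding m_def m'_def using coords(1,2)[OF that] by (auto intro!: derivative_eq_intros)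
  have m': "(m' has_real_derivative c) (at t)"
    unfolding m'_def c_def using coords(3,4) by (auto intro!: derivative_eq_intros)
  have le: "fz_le A (f s) (f z)" if "s \<in> I" "z \<in> I" "m s < m z \<or> s = z" for s z
    using that by (auto simp: f m_def a_def intro!: fz_le_affineI[OF A])
  have "fz_local_min A I f t" if "m' t = 0" "c > 0"
    using second_deriv_test_strict_min[OF I m m' that] le I(2)
    unfolding fz_local_min_def by blast
  moreover have "fz_local_max A I f t" if "m' t = 0" "c < 0"
  proof -
    have "\<exists>U. open U \<and> t \<in> U \<and> (\<forall>z\<in>U \<inter> I - {t}. - m t < - m z)"
      using that m m' by (intro second_deriv_test_strict_min[OF I, of _ "\<lambda>s. - m' s" "- c"])
        (auto intro: DERIV_minus)
    then show ?thesis
      using le I(2) unfolding fz_local_max_def neg_less_iff_less by blast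
  qed
  ultimately show ?thesis by (simp add: m'_def c_def a_def)
qed

end
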